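(* Let $A$ be a zero-product balanced, unital algebra over a field of characteristic $\neq 2$. For a fully noncentral subspace $V\subseteq A$, the following are equivalent: (1) $V$ is a Lie ideal in $A$. (2) $V$ is invariant under all inner automorphisms of $A$. (3) $[A,A]\subseteq V$.
   Context: Algebras are associative; ideals are two-sided. An algebra $A$ over a field $\mathbb{F}$ is zero-product balanced if for all $x,y,z\in A$ the element $xy\otimes z-x\otimes yz\in A\otimes_{\mathbb{F}}A$ belongs to the linear subspace of $A\otimes_{\mathbb{F}}A$ generated by $\{v\otimes w: v,w\in A,\ vw=0\}$. $[x,y]=xy-yx$. For subsets $G,H$ of $A$, at least one of which is an additive subgroup, $[G,H]$ is the additive subgroup generated by all $[g,h]$ with $g\in G$, $h\in H$. A subset $X\subseteq A$ is fully noncentral if $[A,X]$ is not contained in a proper ideal of $A$. An additive subgroup $V$ is a Lie ideal if $[A,V]\subseteq V$. An inner automorphism of the unital algebra $A$ is a map $a\mapsto vav^{-1}$ with $v\in A$ invertible; $V$ is invariant under it if $vVv^{-1}\subseteq V$. *)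

theory Defs
  imports
    "HOL-Library.Poly_Mapping"
    "HOL-Library.Set_Algebras"
    "HOL-Computational_Algebra.Computational_Algebra"
begin

text \<open>
  A unital algebra is one whose type has sort \<open>{ring, monoid_mult}\<close>; unlike \<open>ring_1\<close>, this
  does not exclude the zero algebra.
\<close>

locale associative_algebra = vector_space scale
  for scale :: "'f::field \<Rightarrow> 'a::ring \<Rightarrow> 'a" +
  assumes scale_mult_left: "scale c x * y = scale c (x * y)"
    and scale_mult_right: "x * scale c y = scale c (x * y)"

definition free_scale :: "'f::field \<Rightarrow> ('x \<Rightarrow>\<^sub>0 'f) \<Rightarrow> ('x \<Rightarrow>\<^sub>0 'f)"
  where "free_scale c = Poly_Mapping.map ((*) c)"

lemma lookup_free_scale: "Poly_Mapping.lookup (free_scale c p) i = c * Poly_Mapping.lookup p i"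
  unfolding free_scale_def by transfer (simp add: when_def)

global_interpretation free: vector_space "free_scale :: 'f::field \<Rightarrow> ('x \<Rightarrow>\<^sub>0 'f) \<Rightarrow> ('x \<Rightarrow>\<^sub>0 'f)"
  by unfold_locales
    (auto intro!: poly_mapping_eqI simp: lookup_free_scale lookup_add algebra_simps)

abbreviation free_basis :: "'a \<Rightarrow> 'a \<Rightarrow> ('a \<times> 'a \<Rightarrow>\<^sub>0 'f::field)"
  where "free_basis x y \<equiv> Poly_Mapping.single (x, y) 1"

text \<open>
  The tensor product \<open>A \<otimes> A\<close> over the field is the quotient of the vector space with basis
  \<open>A \<times> A\<close> by the subspace below. Its elements are represented as cosets of that subspace.
\<close>

definition bilinear_relations ::
    "('f::field \<Rightarrow> 'a::ab_group_add \<Rightarrow> 'a) \<Rightarrow> ('a \<times> 'a \<Rightarrow>\<^sub>0 'f) set"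
  where "bilinear_relations scale = free.span
    ({free_basis (x + x') y - free_basis x y - free_basis x' y | x x' y. True} \<union>
     {free_basis x (y + y') - free_basis x y - free_basis x y' | x y y'. True} \<union>
     {free_basis (scale c x) y - free_scale c (free_basis x y) | c x y. True} \<union>
     {free_basis x (scale c y) - free_scale c (free_basis x y) | c x y. True})"

definition tensor_space ::
    "('f::field \<Rightarrow> 'a::ab_group_add \<Rightarrow> 'a) \<Rightarrow> ('a \<times> 'a \<Rightarrow>\<^sub>0 'f) set set"
  where "tensor_space scale = range (\<lambda>p. p +o bilinear_relations scale)"

definition tensor ::
    "('f::field \<Rightarrow> 'a::ab_group_add \<Rightarrow> 'a) \<Rightarrow> 'a \<Rightarrow> 'a \<Rightarrow> ('a \<times> 'a \<Rightarrow>\<^sub>0 'f) set"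
  where "tensor scale x y = free_basis x y +o bilinear_relations scale"

text \<open>
  The sum of two cosets is their elementwise sum. For scalar multiples the subspace has to be
  added, since the elementwise multiple by \<open>0\<close> is \<open>{0}\<close> and not a coset.
\<close>

definition tensor_scale ::
    "('f::field \<Rightarrow> 'a::ab_group_add \<Rightarrow> 'a) \<Rightarrow> 'f \<Rightarrow> ('a \<times> 'a \<Rightarrow>\<^sub>0 'f) set \<Rightarrow> ('a \<times> 'a \<Rightarrow>\<^sub>0 'f) set"
  where "tensor_scale scale c X = free_scale c ` X + bilinear_relations scale"

definition tensor_diff ::
    "('f::field \<Rightarrow> 'a::ab_group_add \<Rightarrow> 'a) \<Rightarrow>
     ('a \<times> 'a \<Rightarrow>\<^sub>0 'f) set \<Rightarrow> ('a \<times> 'a \<Rightarrow>\<^sub>0 'f) set \<Rightarrow> ('a \<times> 'a \<Rightarrow>\<^sub>0 'f) set"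
  where "tensor_diff scale X Y = X + tensor_scale scale (- 1) Y"

lemma coset_add:
  "(p +o bilinear_relations scale) + (q +o bilinear_relations scale) =
   (p + q) +o bilinear_relations scale"
proof -
  have "bilinear_relations scale + bilinear_relations scale = bilinear_relations scale"
    unfolding bilinear_relations_def set_plus_def
    by (force intro: free.span_add free.span_zero)
  then show ?thesis
    by (simp add: set_plus_rearrange)
qed

lemma coset_scale:
  "tensor_scale scale c (p +o bilinear_relations scale) =
   free_scale c p +o bilinear_relations scale"
proof (rule set_eqI)
  fix r
  let ?N = "bilinear_relations scale"
  have zero: "0 \<in> ?N"
    unfolding bilinear_relations_def by (rule free.span_zero)
  show "r \<in> tensor_scale scale c (p +o ?N) \<longleftrightarrow> r \<in> free_scale c p +o ?N"
  proof
    assume "r \<in> tensor_scale scale c (p +o ?N)"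
    then obtain x y where "x \<in> ?N" "y \<in> ?N" and r: "r = free_scale c (p + x) + y"
      unfolding tensor_scale_def set_plus_def elt_set_plus_def by blast
    then have "free_scale c x + y \<in> ?N"
      unfolding bilinear_relations_def by (blast intro: free.span_add free.span_scale)
    moreover have "r = free_scale c p + (free_scale c x + y)"
      unfolding r free.scale_right_distrib by (rule add.assoc)
    ultimately show "r \<in> free_scale c p +o ?N"
      unfolding elt_set_plus_def by blast
  next
    assume "r \<in> free_scale c p +o ?N"
    then obtain y where "y \<in> ?N" "r = free_scale c p + y"
      unfolding elt_set_plus_def by blast
    moreover have "p \<in> p +o ?N"
      using set_plus_intro2[OF zero, of p] by simp
    ultimately show "r \<in> tensor_scale scale c (p +o ?N)"
      unfolding tensor_scale_def by (blast intro: set_plus_intro)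
  qed
qed

lemma coset_diff:
  "tensor_diff scale (p +o bilinear_relations scale) (q +o bilinear_relations scale) =
   (p - q) +o bilinear_relations scale"
proof -
  have "free_scale (- 1) q = - q"
    by simp
  then show ?thesis
    unfolding tensor_diff_def by (simp add: coset_scale coset_add)
qed

definition tensor_subspace ::
    "('f::field \<Rightarrow> 'a::ab_group_add \<Rightarrow> 'a) \<Rightarrow> ('a \<times> 'a \<Rightarrow>\<^sub>0 'f) set set \<Rightarrow> bool"
  where "tensor_subspace scale W \<longleftrightarrow>
    W \<subseteq> tensor_space scale \<and>
    bilinear_relations scale \<in> W \<and> \<comment> \<open>the zero of the quotient\<close>
    (\<forall>X\<in>W. \<forall>Y\<in>W. X + Y \<in> W) \<and>
    (\<forall>c. \<forall>X\<in>W. tensor_scale scale c X \<in> W)"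

definition tensor_span ::
    "('f::field \<Rightarrow> 'a::ab_group_add \<Rightarrow> 'a) \<Rightarrow>
     ('a \<times> 'a \<Rightarrow>\<^sub>0 'f) set set \<Rightarrow> ('a \<times> 'a \<Rightarrow>\<^sub>0 'f) set set"
  where "tensor_span scale S = \<Inter>{W. tensor_subspace scale W \<and> S \<subseteq> W}"

definition zero_product_balanced :: "('f::field \<Rightarrow> 'a::ring \<Rightarrow> 'a) \<Rightarrow> bool"
  where "zero_product_balanced scale \<longleftrightarrow>
    (\<forall>x y z. tensor_diff scale (tensor scale (x * y) z) (tensor scale x (y * z))
      \<in> tensor_span scale {tensor scale v w | v w. v * w = 0})"

definition additive_subgroup :: "'a::ab_group_add set \<Rightarrow> bool"
  where "additive_subgroup V \<longleftrightarrow> 0 \<in> V \<and> (\<forall>x\<in>V. \<forall>y\<in>V. x - y \<in> V)"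

definition commutator :: "'a::ring \<Rightarrow> 'a \<Rightarrow> 'a"
  where "commutator x y = x * y - y * x"

definition commutator_subgroup :: "'a::ring set \<Rightarrow> 'a set \<Rightarrow> 'a set"
  where "commutator_subgroup G H = group_closure {commutator g h | g h. g \<in> G \<and> h \<in> H}"

text \<open>
  In a unital algebra every two-sided ring ideal is a linear subspace, so closure under
  scalar multiplication is not required separately.
\<close>

definition two_sided_ideal :: "'a::ring set \<Rightarrow> bool"
  where "two_sided_ideal I \<longleftrightarrow>
    additive_subgroup I \<and> (\<forall>a. \<forall>x\<in>I. a * x \<in> I \<and> x * a \<in> I)"

definition fully_noncentral :: "'a::ring set \<Rightarrow> bool"
  where "fully_noncentral X \<longleftrightarrow>
    \<not> (\<exists>I. two_sided_ideal I \<and> I \<noteq> UNIV \<and> commutator_subgroup UNIV X \<subseteq> I)"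

definition lie_ideal :: "'a::ring set \<Rightarrow> bool"
  where "lie_ideal V \<longleftrightarrow> additive_subgroup V \<and> commutator_subgroup UNIV V \<subseteq> V"

definition inner_automorphism :: "('a::monoid_mult \<Rightarrow> 'a) \<Rightarrow> bool"
  where "inner_automorphism f \<longleftrightarrow>
    (\<exists>v v'. v * v' = 1 \<and> v' * v = 1 \<and> f = (\<lambda>a. v * a * v'))"

definition inner_invariant :: "'a::monoid_mult set \<Rightarrow> bool"
  where "inner_invariant V \<longleftrightarrow> (\<forall>f. inner_automorphism f \<longrightarrow> f ` V \<subseteq> V)"

end

theory Submission
  imports Defs
begin

text \<open>
  Both (1) and (2) imply that \<open>V\<close> is normalised by \<open>[A,A]\<close>: zero-product balance makes every
  commutator a combination of elements \<open>n = wv\<close> with \<open>vw = 0\<close>, and for those \<open>n\<close> the elements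
  \<open>1 + n\<close> and \<open>1 - n\<close> are mutually inverse, so that subtracting the two conjugations by them
  gives \<open>2[n,x] \<in> V\<close> for \<open>x \<in> V\<close>.

  If \<open>V\<close> is normalised by \<open>[A,A]\<close>, then \<open>T = {t. [t,A] \<subseteq> V}\<close> is a subring which is normalised
  by \<open>[A,A]\<close> and contains \<open>[V,V]\<close>. Suppose that the largest ideal \<open>J\<close> contained in \<open>T\<close> is proper,
  and let \<open>P \<supseteq> J\<close> be a prime ideal. All products \<open>[a,c][a,t]\<close> with \<open>a, c, t \<in> T\<close> lie in \<open>J\<close>,
  which forces \<open>T\<close> to be commutative, and then central, modulo \<open>P\<close>. So \<open>[V,V]\<close> is central
  modulo \<open>P\<close>, hence zero, hence \<open>V\<close> is central modulo \<open>P\<close>, against full noncentrality.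
  Therefore \<open>T = A\<close>, that is, \<open>[A,A] \<subseteq> V\<close>.
\<close>

section \<open>Additive subgroups and ideals\<close>

lemma additive_subgroup_zero: "additive_subgroup S \<Longrightarrow> 0 \<in> S"
  and additive_subgroup_diff: "additive_subgroup S \<Longrightarrow> x \<in> S \<Longrightarrow> y \<in> S \<Longrightarrow> x - y \<in> S"
  by (simp_all add: additive_subgroup_def)

lemma additive_subgroup_uminus: "additive_subgroup S \<Longrightarrow> x \<in> S \<Longrightarrow> - x \<in> S"
  using additive_subgroup_diff[of S 0 x] by (simp add: additive_subgroup_zero)

lemma additive_subgroup_add: "additive_subgroup S \<Longrightarrow> x \<in> S \<Longrightarrow> y \<in> S \<Longrightarrow> x + y \<in> S"
  using additive_subgroup_diff[of S x "- y"] by (simp add: additive_subgroup_uminus)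

lemma commutator_swap: "commutator y x = - commutator x y"
  by (simp add: commutator_def)

lemma commutator_mem_swap:
  "additive_subgroup S \<Longrightarrow> commutator x y \<in> S \<Longrightarrow> commutator y x \<in> S"
  by (metis commutator_swap additive_subgroup_uminus)

lemma commutator_subgroup_subset_iff:
  assumes "additive_subgroup S"
  shows "commutator_subgroup G H \<subseteq> S \<longleftrightarrow> (\<forall>g\<in>G. \<forall>h\<in>H. commutator g h \<in> S)"
proof
  assume "commutator_subgroup G H \<subseteq> S"
  then show "\<forall>g\<in>G. \<forall>h\<in>H. commutator g h \<in> S"
    unfolding commutator_subgroup_def by (blast intro: group_closure.base)
next
  assume gens: "\<forall>g\<in>G. \<forall>h\<in>H. commutator g h \<in> S"
  show "commutator_subgroup G H \<subseteq> S"
  proof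
    fix s
    assume "s \<in> commutator_subgroup G H"
    then show "s \<in> S"
      unfolding commutator_subgroup_def
    proof (induction rule: group_closure.induct)
      case (base s)
      then show ?case
        using gens additive_subgroup_zero[OF assms] by blast
    next
      case (diff s t)
      then show ?case
        using additive_subgroup_diff[OF assms] by blast
    qed
  qed
qed

text \<open>For an additive subgroup \<open>S\<close> of a unital ring this is the largest two-sided
  ideal inside \<open>S\<close>: \<open>b = c = 1\<close> puts it inside \<open>S\<close>, and it
  contains every ideal that \<open>S\<close> contains.\<close>

definition ideal_core :: "'a::ring set \<Rightarrow> 'a set"
  where "ideal_core S = {x. \<forall>b c. b * x * c \<in> S}"

lemma two_sided_ideal_ideal_core:
  assumes "additive_subgroup S"
  shows "two_sided_ideal (ideal_core S)"
  unfolding two_sided_ideal_def additive_subgroup_def ideal_core_def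
  using additive_subgroup_zero[OF assms] additive_subgroup_diff[OF assms]
  by (auto simp: right_diff_distrib left_diff_distrib) (metis mult.assoc)+

lemma ideal_core_eq_UNIV:
  fixes S :: "'a::{ring,monoid_mult} set"
  assumes "ideal_core S = UNIV"
  shows "S = UNIV"
proof -
  have "x * 1 * 1 \<in> S" for x
    using assms unfolding ideal_core_def by blast
  then show ?thesis
    by auto
qed

section \<open>Prime ideals\<close>

text \<open>Membership in \<open>P\<close> stands for vanishing in the quotient ring, which is prime
  or zero and has no 2-torsion. Computing modulo \<open>P\<close> avoids forming that
  quotient.\<close>

locale odd_prime_ideal =
  fixes P :: "'a::ring set"
  assumes ideal: "two_sided_ideal P"
    and prime: "(\<And>r. a * r * b \<in> P) \<Longrightarrow> a \<in> P \<or> b \<in> P"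
    and half: "a + a \<in> P \<Longrightarrow> a \<in> P"
begin

lemma subgroup: "additive_subgroup P"
  using ideal by (simp add: two_sided_ideal_def)

lemmas add = additive_subgroup_add[OF subgroup]
  and diff = additive_subgroup_diff[OF subgroup]
  and uminus = additive_subgroup_uminus[OF subgroup]
  and comm_swap = commutator_mem_swap[OF subgroup]

lemma left: "x \<in> P \<Longrightarrow> a * x \<in> P"
  and right: "x \<in> P \<Longrightarrow> x * a \<in> P"
  using ideal by (auto simp: two_sided_ideal_def)

lemma comm_left: "x \<in> P \<Longrightarrow> commutator a x \<in> P"
  and comm_right: "x \<in> P \<Longrightarrow> commutator x a \<in> P"
  unfolding commutator_def by (blast intro: diff left right)+

lemmas mem = add diff uminus left right comm_left comm_right

text \<open>The derivation \<open>d = [v,_]\<close> satisfies \<open>d\<^sup>2(xy) = d\<^sup>2(x)y + 2d(x)d(y) + xd\<^sup>2(y)\<close>.\<close>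

lemma central_if_double_commutator:
  assumes dd: "\<And>x. commutator v (commutator v x) \<in> P"
  shows "commutator v x \<in> P"
proof -
  have prod: "commutator v x * commutator v y \<in> P" for x y
  proof (rule half)
    have "commutator v x * commutator v y + commutator v x * commutator v y =
      commutator v (commutator v (x * y)) - commutator v (commutator v x) * y
        - x * commutator v (commutator v y)"
      by (simp add: commutator_def algebra_simps)
    then show "commutator v x * commutator v y + commutator v x * commutator v y \<in> P"
      using dd by (simp add: mem)
  qed
  have "commutator v x * b * commutator v x \<in> P" for b
  proof -
    \<comment> \<open>Replacing \<open>y\<close> by \<open>b * x\<close> in \<open>prod\<close>
      inserts an arbitrary \<open>b\<close> between two copies of \<open>d(x)\<close>, as primeness
      demands.\<close>
    have "commutator v x * b * commutator v x =
      commutator v x * commutator v (b * x) - commutator v x * commutator v b * x"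
      by (simp add: commutator_def algebra_simps)
    then show ?thesis
      using prod by (simp add: mem)
  qed
  then show ?thesis
    using prime by blast
qed

text \<open>For \<open>d = [v,_]\<close>, each \<open>a = d^2(y)\<close> lies in \<open>V\<close>
  and so commutes with \<open>V\<close> modulo \<open>P\<close>. This makes every
  \<open>a q a p a\<close> vanish modulo \<open>P\<close>; primeness then gives
  \<open>d^2 = 0\<close>, and hence \<open>d = 0\<close>, modulo \<open>P\<close>.\<close>

lemma central_if_commutative:
  assumes normal: "\<And>v x y. v \<in> V \<Longrightarrow> commutator v (commutator x y) \<in> V"
    and commutative: "\<And>v w. v \<in> V \<Longrightarrow> w \<in> V \<Longrightarrow> commutator v w \<in> P"
    and v: "v \<in> V"
  shows "commutator v x \<in> P"
proof (rule central_if_double_commutator)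
  fix y
  define u where "u = commutator v y"
  define a where "a = commutator v u"
  have aV: "a \<in> V"
    using normal v by (auto simp: a_def u_def)
  have va: "commutator v a \<in> P"
    using commutative v aV by blast
  have sq: "a * a \<in> P"
  proof -
    \<comment> \<open>Apply \<open>d^2\<close> to \<open>[vy,u] = v[y,u] + ay\<close>: the term
      \<open>a d^2(y)\<close> is \<open>a * a\<close>. The values \<open>d^2([p,u])\<close> vanish
      modulo \<open>P\<close> because \<open>[v,[p,u]]\<close> lies in \<open>V\<close>.\<close>
    have "a * a = commutator v (commutator v (commutator (v * y) u))
        - v * commutator v (commutator v (commutator y u))
        - commutator v (commutator v a) * y - (commutator v a * u + commutator v a * u)"
      by (simp add: a_def u_def commutator_def algebra_simps)
    moreover have "commutator v (commutator v (commutator p u)) \<in> P" for p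
      using commutative normal v by blast
    ultimately show ?thesis
      using va by (simp add: mem)
  qed
  have comm: "a * commutator p q * a \<in> P" for p q
  proof (rule half)
    have "a * commutator p q * a + a * commutator p q * a =
      a * a * commutator p q + commutator p q * (a * a)
        - commutator a (commutator a (commutator p q))"
      by (simp add: commutator_def algebra_simps)
    then show "a * commutator p q * a + a * commutator p q * a \<in> P"
      using sq commutative[OF aV normal[OF aV]] by (simp add: mem)
  qed
  have "a * q * a * p * a \<in> P" for p q
  proof -
    \<comment> \<open>With \<open>q * a\<close> in place of \<open>q\<close>, one half of the inner
      commutator produces \<open>a * a\<close>.\<close>
    have "a * q * a * p * a = a * p * q * (a * a) - a * commutator p (q * a) * a"
      by (simp add: commutator_def algebra_simps)
    then show ?thesis
      using sq comm by (simp add: mem)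
  qed
  then have "a * q * a \<in> P \<or> a \<in> P" for q
    using prime[of "a * q * a" a] by blast
  then have "a \<in> P"
    using prime[of a a] by blast
  then show "commutator v (commutator v y) \<in> P"
    by (simp add: a_def u_def)
qed

text \<open>If \<open>z = [v,w]\<close> were not in \<open>P\<close>, it could be cancelled modulo
  \<open>P\<close>, being central there. For the derivations \<open>D = [v,_]\<close> and
  \<open>E = [w,_]\<close> this kills successively \<open>EDD\<close>, \<open>ED\<close> and
  \<open>D\<close> modulo \<open>P\<close>, against \<open>D w = z\<close>.\<close>

lemma commutative_if_commutators_central:
  assumes normal: "\<And>v x y. v \<in> V \<Longrightarrow> commutator v (commutator x y) \<in> V"
    and central: "\<And>v w x. v \<in> V \<Longrightarrow> w \<in> V \<Longrightarrow> commutator (commutator v w) x \<in> P"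
    and v: "v \<in> V" and w: "w \<in> V"
  shows "commutator v w \<in> P"
proof (rule ccontr)
  define z where "z = commutator v w"
  assume "commutator v w \<notin> P"
  then have notP: "z \<notin> P"
    by (simp add: z_def)
  have z: "commutator z b \<in> P" for b
    using central v w by (simp add: z_def)
  have z': "commutator b z \<in> P" for b
    using z by (rule comm_swap)
  have cancel: "c \<in> P" if "z * c \<in> P" for c
  proof -
    have "z * r * c = commutator z r * c + r * (z * c)" for r
      by (simp add: commutator_def algebra_simps)
    then have "z * r * c \<in> P" for r
      using z that by (simp add: mem)
    then show ?thesis
      using prime notP by blast
  qed
  let ?D = "commutator v" and ?E = "commutator w"
  \<comment> \<open>Here \<open>D(vy) = v D(y)\<close>, \<open>E v = -z\<close>, and
    \<open>DE - ED = [z,_]\<close>.\<close>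
  have DEvDy: "?D (?E (?D (v * y))) = v * ?E (?D (?D y)) - z * ?D (?D y)
      - ?D z * ?D y + v * commutator z (?D y)" for y
    by (simp add: z_def commutator_def algebra_simps)
  \<comment> \<open>The inner double commutators lie in \<open>V\<close> by \<open>normal\<close>,
    so this and the next expression are commutators of two elements of \<open>V\<close>.\<close>
  have EDDy_central: "commutator (?E (?D (?D y))) b \<in> P" for y b
    using central normal v w by blast
  have DED_central: "commutator (?D (?E (?D y))) b \<in> P" for y b
    using central normal v w by blast
  have EDDy: "?E (?D (?D y)) \<in> P" for y
  proof (rule cancel, rule half)
    let ?c = "?E (?D (?D y))"
    \<comment> \<open>Apply \<open>E\<close> to \<open>DEvDy\<close>: its left side becomes zero
      modulo \<open>P\<close>, while the factors \<open>v\<close> (through \<open>E v = -z\<close>)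
      and \<open>D(D y)\<close> each contribute one \<open>-z * c\<close>.\<close>
    have "z * ?c + z * ?c = v * ?E ?c - ?E z * ?D (?D y) - ?E (?D z * ?D y)
        + ?E (v * commutator z (?D y)) - ?E (?D (?E (?D (v * y))))"
    proof -
      have "?E (v * c - z * d - p + q) =
          v * ?E c + ?E v * c - ?E z * d - z * ?E d - ?E p + ?E q" for c d p q
        by (simp add: commutator_def algebra_simps)
      moreover have "?E v = - z"
        unfolding z_def by (rule commutator_swap)
      ultimately show ?thesis
        unfolding DEvDy by simp
    qed
    moreover have "?E ?c \<in> P" "?E (?D (?E (?D (v * y)))) \<in> P"
      using EDDy_central DED_central by (blast intro: comm_swap)+
    ultimately show "z * ?c + z * ?c \<in> P"
      using z z' by (simp add: mem)
  qed
  have DDy_central: "commutator (?D (?D y)) b \<in> P" for y b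
  proof (rule cancel)
    let ?r = "v * ?E (?D (?D y)) - ?D z * ?D y + v * commutator z (?D y)"
    have "z * ?D (?D y) = ?r - ?D (?E (?D (v * y)))"
      unfolding DEvDy by simp
    moreover have "z * commutator c b = commutator (z * c) b - commutator z b * c" for c
      by (simp add: commutator_def algebra_simps)
    moreover have "commutator (p - q) b = commutator p b - commutator q b" for p q
      by (simp add: commutator_def algebra_simps)
    ultimately have "z * commutator (?D (?D y)) b = commutator ?r b
        - commutator (?D (?E (?D (v * y)))) b - commutator z b * ?D (?D y)"
      by simp
    moreover have "?r \<in> P"
      using EDDy z z' by (simp add: mem)
    ultimately show "z * commutator (?D (?D y)) b \<in> P"
      using DED_central z by (simp add: mem)
  qed
  have EDy: "?E (?D y) \<in> P" for y
  proof (rule cancel, rule half)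
    \<comment> \<open>Since \<open>D w = z\<close> and \<open>E w = 0\<close>, expanding
      \<open>EDD(wy)\<close> yields \<open>z * E(D y)\<close> twice.\<close>
    have "z * ?E (?D y) + z * ?E (?D y) = ?E (?D (?D (w * y))) - w * ?E (?D (?D y))
        - ?E (?D z * y) - ?E z * ?D y - ?E z * ?D y"
      by (simp add: z_def commutator_def algebra_simps)
    then show "z * ?E (?D y) + z * ?E (?D y) \<in> P"
      using EDDy z' by (simp add: mem)
  qed
  have "?D y \<in> P" for y
  proof (rule cancel)
    have "z * ?D y = v * ?E (?D y) - ?E (?D (v * y))"
      by (simp add: z_def commutator_def algebra_simps)
    then show "z * ?D y \<in> P"
      using EDy by (simp add: mem)
  qed
  then show False
    using notP by (simp add: z_def)
qed

text \<open>For \<open>n = [a,c]\<close> the hypothesis on products puts \<open>n T n\<close> into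
  \<open>P\<close>. Normality transfers this to the whole ring: each \<open>m = n x n\<close>
  satisfies \<open>m y m y m = 0\<close> modulo \<open>P\<close> for all \<open>y\<close>, and
  linearising this identity forces \<open>m\<close>, then \<open>n\<close>, into
  \<open>P\<close>.\<close>

lemma commutative_if_commutator_products:
  assumes diff_T: "\<And>s t. s \<in> T \<Longrightarrow> t \<in> T \<Longrightarrow> s - t \<in> T"
    and mult_T: "\<And>s t. s \<in> T \<Longrightarrow> t \<in> T \<Longrightarrow> s * t \<in> T"
    and normal: "\<And>t x y. t \<in> T \<Longrightarrow> commutator t (commutator x y) \<in> T"
    and products: "\<And>a c t. a \<in> T \<Longrightarrow> c \<in> T \<Longrightarrow> t \<in> T \<Longrightarrow>
      commutator a c * commutator a t \<in> P"
    and a: "a \<in> T" and c: "c \<in> T"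
  shows "commutator a c \<in> P"
proof -
  define n where "n = commutator a c"
  have n: "n \<in> T"
    unfolding n_def using a c by (simp add: commutator_def diff_T mult_T)
  have sq: "n * n \<in> P"
    unfolding n_def using products a c by blast
  have nsn: "n * s * n \<in> P" if "s \<in> T" for s
  proof -
    have "n * s * n = commutator a (c * s) * commutator a c
        - c * (commutator a s * commutator a c)"
      by (simp add: n_def commutator_def algebra_simps)
    then show ?thesis
      using products a c that mult_T by (simp add: mem)
  qed
  have "n * x * n \<in> P" for x
  proof -
    define m where "m = n * x * n"
    have cube: "m * y * m * y * m \<in> P" for y
    proof -
      \<comment> \<open>As \<open>u\<close> is a commutator, \<open>[[n,u],u]\<close> lies in
        \<open>T\<close>, so \<open>nsn\<close> applies to it. The factor \<open>n\<close> in
        \<open>x * n\<close> makes all terms of \<open>n u n u n x n\<close> other than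
        \<open>m y m y m\<close> contain \<open>n * n\<close>.\<close>
      define u where "u = commutator (x * n) y"
      have "n * u * n * u * n \<in> P"
      proof (rule half)
        have "n * u * n * u * n + n * u * n * u * n = n * n * u * u * n + n * u * u * (n * n)
            - n * commutator (commutator n u) u * n"
          by (simp add: commutator_def algebra_simps)
        moreover have "commutator (commutator n u) u \<in> T"
          unfolding u_def by (intro normal n)
        ultimately show "n * u * n * u * n + n * u * n * u * n \<in> P"
          using sq nsn by (simp add: mem)
      qed
      moreover have "m * y * m * y * m = (n * u * n * u * n + m * y * n * y * x * (n * n)
          + n * y * x * (n * n) * x * n * y * n - n * y * x * (n * n) * y * x * (n * n)) * (x * n)"
        by (simp add: m_def u_def commutator_def algebra_simps)
      ultimately show ?thesis
        using sq by (simp add: mem)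
    qed
    have "(m * y * m) * r * (m * y * m) \<in> P" for y r
    proof -
      \<comment> \<open>Linearise \<open>cube\<close> at \<open>y\<close> and
        \<open>y * m * r\<close>: one mixed term contains \<open>m y m y m\<close>, the other is the
        required product.\<close>
      let ?y' = "y * m * r"
      have "(m * y * m) * r * (m * y * m) = m * (y + ?y') * m * (y + ?y') * m
          - m * y * m * y * m - m * ?y' * m * ?y' * m - m * y * m * y * m * r * m"
        by (simp add: algebra_simps)
      moreover have "m * y * m * y * m * r * m \<in> P"
        using cube by (rule right[OF right])
      ultimately show ?thesis
        using cube by (simp only: diff)
    qed
    then have "m * y * m \<in> P" for y
      using prime by blast
    then show ?thesis
      unfolding m_def[symmetric] using prime by blast
  qed
  then show ?thesis
    using prime n_def by blast
qed

end

section \<open>Maximal ideals and reduction to prime quotients\<close>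

lemma maximal_ideal_exists:
  fixes J :: "'a::{ring,monoid_mult} set"
  assumes J: "two_sided_ideal J" "1 \<notin> J"
  obtains M where "two_sided_ideal M" "J \<subseteq> M" "1 \<notin> M"
    "\<And>I. two_sided_ideal I \<Longrightarrow> M \<subseteq> I \<Longrightarrow> 1 \<notin> I \<Longrightarrow> I = M"
proof -
  \<comment> \<open>Properness is expressed as omitting \<open>1\<close>, which passes to unions of
    chains.\<close>
  let ?A = "{I. two_sided_ideal I \<and> J \<subseteq> I \<and> 1 \<notin> I}"
  have "\<exists>M\<in>?A. \<forall>I\<in>?A. M \<subseteq> I \<longrightarrow> I = M"
  proof (rule subset_Zorn_nonempty)
    show "?A \<noteq> {}"
      using J by blast
  next
    fix C
    assume ne: "C \<noteq> {}" and chain: "subset.chain ?A C"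
    have C: "two_sided_ideal I" "J \<subseteq> I" "1 \<notin> I" if "I \<in> C" for I
      using chain that by (auto simp: subset.chain_def)
    have "x - y \<in> \<Union>C" if xy: "x \<in> \<Union>C" "y \<in> \<Union>C" for x y
    proof -
      obtain I I' where I: "I \<in> C" "x \<in> I" "I' \<in> C" "y \<in> I'"
        using xy by blast
      then have "I \<subseteq> I' \<or> I' \<subseteq> I"
        using chain by (auto simp: subset.chain_def)
      then show ?thesis
        using I C by (meson UnionI additive_subgroup_def subsetD two_sided_ideal_def)
    qed
    moreover have "0 \<in> \<Union>C"
      using ne C(1) by (auto simp: two_sided_ideal_def additive_subgroup_def)
    ultimately have "two_sided_ideal (\<Union>C)"
      using C(1) unfolding two_sided_ideal_def additive_subgroup_def by blast
    then show "\<Union>C \<in> ?A"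
      using ne C by blast
  qed
  then obtain M where M: "M \<in> ?A" "\<forall>I\<in>?A. M \<subseteq> I \<longrightarrow> I = M"
    by (rule bexE)
  show ?thesis
    by (rule that[of M]) (use M in auto)
qed

text \<open>A proper \<open>J\<close> would lie in a maximal ideal. That ideal is prime and
  satisfies \<open>half\<close>, because \<open>h\<close> is one half of the unit. Centrality of
  \<open>V\<close> modulo it would put \<open>[A,V]\<close> into a proper ideal.\<close>

lemma ideal_eq_UNIV:
  fixes J V :: "'a::{ring,monoid_mult} set"
  assumes h: "h + h = (1::'a)"
    and noncentral: "fully_noncentral V"
    and J: "two_sided_ideal J"
    and central: "\<And>P v x. odd_prime_ideal P \<Longrightarrow> J \<subseteq> P \<Longrightarrow> v \<in> V \<Longrightarrow> commutator v x \<in> P"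
  shows "J = UNIV"
proof (rule ccontr)
  assume "J \<noteq> UNIV"
  then have "1 \<notin> J"
    using J unfolding two_sided_ideal_def by (metis UNIV_eq_I mult_1_right)
  with J obtain M where M: "two_sided_ideal M" "J \<subseteq> M" "1 \<notin> M"
    and maximal: "\<And>I. two_sided_ideal I \<Longrightarrow> M \<subseteq> I \<Longrightarrow> 1 \<notin> I \<Longrightarrow> I = M"
    by (rule maximal_ideal_exists) blast
  have subgroup: "additive_subgroup M"
    and mult: "\<And>a x. x \<in> M \<Longrightarrow> a * x \<in> M" "\<And>a x. x \<in> M \<Longrightarrow> x * a \<in> M"
    using M(1) by (auto simp: two_sided_ideal_def)
  have "odd_prime_ideal M"
  proof
    show "two_sided_ideal M" by fact
  next
    fix a b
    assume ab: "\<And>r. a * r * b \<in> M"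
    \<comment> \<open>The left annihilator of \<open>A b\<close> modulo \<open>M\<close> is an ideal
      containing \<open>M\<close>; maximality leaves only \<open>M\<close> itself or an ideal
      containing \<open>1\<close>, and the latter puts \<open>b\<close> into
      \<open>M\<close>.\<close>
    let ?I = "{x. \<forall>r. x * r * b \<in> M}"
    have "two_sided_ideal ?I"
      unfolding two_sided_ideal_def additive_subgroup_def
      using additive_subgroup_zero[OF subgroup] additive_subgroup_diff[OF subgroup] mult(1)
      by (auto simp: left_diff_distrib mult.assoc) (metis mult.assoc)
    moreover have "M \<subseteq> ?I"
      using mult by blast
    ultimately have "?I = M \<or> 1 \<in> ?I"
      using maximal by blast
    then show "a \<in> M \<or> b \<in> M"
    proof
      assume "1 \<in> ?I"
      then have "1 * 1 * b \<in> M" by blast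
      then show ?thesis by simp
    qed (use ab in blast)
  next
    fix a
    assume "a + a \<in> M"
    then have "h * (a + a) \<in> M"
      by (rule mult)
    also have "h * (a + a) = (h + h) * a"
      by (simp add: algebra_simps)
    finally show "a \<in> M"
      by (simp add: h)
  qed
  then have "\<forall>a\<in>UNIV. \<forall>v\<in>V. commutator a v \<in> M"
    using central M(2) commutator_mem_swap[OF subgroup] by blast
  then have "commutator_subgroup UNIV V \<subseteq> M"
    by (simp add: commutator_subgroup_subset_iff[OF subgroup])
  then show False
    using noncentral M unfolding fully_noncentral_def by blast
qed

section \<open>Subspaces normalised by commutators\<close>

text \<open>Commutators of commutators lie in \<open>ideal_core S\<close>. Modulo a prime containing
  this ideal, two uses of the double commutator lemma make first every commutator and then every
  element central.\<close>

lemma subring_of_commutators_eq_UNIV: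
  fixes S V :: "'a::{ring,monoid_mult} set"
  assumes h: "h + h = (1::'a)"
    and noncentral: "fully_noncentral V"
    and S: "additive_subgroup S"
    and mult: "\<And>s t. s \<in> S \<Longrightarrow> t \<in> S \<Longrightarrow> s * t \<in> S"
    and comm: "\<And>x y. commutator x y \<in> S"
  shows "S = UNIV"
proof (rule ideal_core_eq_UNIV, rule ideal_eq_UNIV[OF h noncentral two_sided_ideal_ideal_core[OF S]])
  fix P and v x :: 'a
  assume "odd_prime_ideal P" and core: "ideal_core S \<subseteq> P"
  then interpret odd_prime_ideal P by blast
  have "commutator (commutator p q) (commutator r s) \<in> ideal_core S" for p q r s
    unfolding ideal_core_def
  proof (intro CollectI allI)
    fix b c
    let ?u = "commutator p q" and ?w = "commutator r s"
    have right: "commutator ?u ?w * d \<in> S" for d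
    proof -
      have "commutator ?u ?w * d = commutator ?u (?w * d) - ?w * commutator ?u d"
        by (simp add: commutator_def algebra_simps)
      then show ?thesis
        using additive_subgroup_diff[OF S] comm mult by metis
    qed
    have "b * commutator ?u ?w * c =
        commutator b (commutator ?u ?w * c) + commutator ?u ?w * (c * b)"
      by (simp add: commutator_def algebra_simps)
    then show "b * commutator ?u ?w * c \<in> S"
      using additive_subgroup_add[OF S] comm right by metis
  qed
  then have "commutator (commutator p q) (commutator (commutator p q) r) \<in> P" for p q r
    using core by blast
  then have "commutator (commutator p q) r \<in> P" for p q r
    by (rule central_if_double_commutator)
  then have "commutator v (commutator v r) \<in> P" for r
    by (blast intro: comm_swap)
  then show "commutator v x \<in> P"
    by (rule central_if_double_commutator)
qed

text \<open>
  The elements generating left ideals inside \<open>T\<close> form a left ideal whose right idealiser contains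
  all commutators and hence is the whole ring.
\<close>

lemma commutator_product_in_ideal_core:
  fixes T V :: "'a::{ring,monoid_mult} set"
  assumes h: "h + h = (1::'a)"
    and noncentral: "fully_noncentral V"
    and T: "additive_subgroup T"
    and mult: "\<And>s t. s \<in> T \<Longrightarrow> t \<in> T \<Longrightarrow> s * t \<in> T"
    and normal: "\<And>t x y. t \<in> T \<Longrightarrow> commutator t (commutator x y) \<in> T"
    and act: "a \<in> T" "c \<in> T" "t \<in> T"
  shows "commutator a c * commutator a t \<in> ideal_core T"
proof -
  note T_diff = additive_subgroup_diff[OF T] and T_add = additive_subgroup_add[OF T]
  have outer: "commutator a b * commutator a s \<in> T" if "s \<in> T" for b s
  proof -
    \<comment> \<open>Since \<open>[a,ba] = [a,b]a\<close>, the Leibniz rule for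
      \<open>[s,_]\<close> isolates the product. Here \<open>b\<close> is arbitrary, while
      \<open>s\<close> lies in \<open>T\<close>.\<close>
    have "commutator a b * commutator a s =
        commutator s (commutator a b) * a - commutator s (commutator a (b * a))"
      by (simp add: commutator_def algebra_simps)
    then show ?thesis
      using that act T_diff mult normal by metis
  qed
  define Q where "Q = {x. \<forall>b. b * x \<in> T}"
  have Q: "commutator a c * commutator a t \<in> Q"
    unfolding Q_def
  proof (intro CollectI allI)
    fix b
    \<comment> \<open>Expanding \<open>[a,bc]\<close> and \<open>[a,ct]\<close>, the terms
      \<open>[a,b] c [a,t]\<close> cancel; each product on the right is covered by
      \<open>outer\<close>, up to a right factor \<open>t\<close>.\<close>
    have "b * (commutator a c * commutator a t) =
        commutator a (b * c) * commutator a t - commutator a b * commutator a (c * t)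
          + commutator a b * commutator a c * t"
      by (simp add: commutator_def algebra_simps)
    then show "b * (commutator a c * commutator a t) \<in> T"
      using outer act mult T_diff T_add by metis
  qed
  have "additive_subgroup Q"
    using T unfolding Q_def additive_subgroup_def by (simp add: right_diff_distrib)
  then have "additive_subgroup {r. \<forall>x\<in>Q. x * r \<in> Q}"
    unfolding additive_subgroup_def by (simp add: right_diff_distrib)
  moreover have "x * commutator p q \<in> Q" if "x \<in> Q" for x p q
    unfolding Q_def
  proof (intro CollectI allI)
    fix b
    have "b * (x * commutator p q) =
        commutator (b * x) (commutator p q) + commutator p q * b * x"
      by (simp add: commutator_def algebra_simps)
    then show "b * (x * commutator p q) \<in> T"
      using that normal T_add unfolding Q_def by simp
  qed
  ultimately have "{r. \<forall>x\<in>Q. x * r \<in> Q} = UNIV"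
    by (intro subring_of_commutators_eq_UNIV[OF h noncentral]) (auto simp: mult.assoc[symmetric])
  then have "commutator a c * commutator a t * r \<in> Q" for r
    using Q by blast
  then show ?thesis
    unfolding ideal_core_def Q_def by (simp add: mult.assoc)
qed

theorem commutators_subset_if_normalised:
  fixes V :: "'a::{ring,monoid_mult} set"
  assumes h: "h + h = (1::'a)"
    and noncentral: "fully_noncentral V"
    and V: "additive_subgroup V"
    and normal: "\<And>v x y. v \<in> V \<Longrightarrow> commutator v (commutator x y) \<in> V"
  shows "commutator x y \<in> V"
proof -
  note V_diff = additive_subgroup_diff[OF V] and V_add = additive_subgroup_add[OF V]
  define T where "T = {t. \<forall>r. commutator t r \<in> V}"
  have T: "additive_subgroup T"
    unfolding additive_subgroup_def
  proof (intro conjI ballI)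
    show "0 \<in> T"
      using additive_subgroup_zero[OF V] by (simp add: T_def commutator_def)
  next
    fix s t
    assume "s \<in> T" "t \<in> T"
    moreover have "commutator (s - t) r = commutator s r - commutator t r" for r
      by (simp add: commutator_def algebra_simps)
    ultimately show "s - t \<in> T"
      by (simp add: T_def V_diff)
  qed
  have T_mult: "s * t \<in> T" if "s \<in> T" "t \<in> T" for s t
  proof -
    \<comment> \<open>Each summand is a commutator of \<open>s\<close> or \<open>t\<close> with a
      ring element, so \<open>T\<close> is closed under products even though \<open>V\<close> need
      not be.\<close>
    have "commutator (s * t) r = commutator s (t * r) + commutator t (r * s)" for r
      by (simp add: commutator_def algebra_simps)
    then show ?thesis
      using that by (simp add: T_def V_add)
  qed
  have T_normal: "commutator t (commutator p q) \<in> T" if "t \<in> T" for t p q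
  proof -
    have "commutator (commutator t (commutator p q)) r =
        commutator t (commutator (commutator p q) r)
          + commutator (commutator t r) (commutator p q)" for r
      by (simp add: commutator_def algebra_simps)
    then show ?thesis
      using that normal by (simp add: T_def V_add)
  qed
  have VV: "commutator v w \<in> T" if "v \<in> V" "w \<in> V" for v w
  proof -
    have "commutator (commutator v w) r =
        commutator v (commutator w r) - commutator w (commutator v r)" for r
      by (simp add: commutator_def algebra_simps)
    then show ?thesis
      using that normal by (simp add: T_def V_diff)
  qed
  have "T = UNIV"
  proof (rule ideal_core_eq_UNIV, rule ideal_eq_UNIV[OF h noncentral two_sided_ideal_ideal_core[OF T]])
    fix P v x
    assume "odd_prime_ideal P" and core: "ideal_core T \<subseteq> P" and v: "v \<in> V"
    then interpret odd_prime_ideal P by blast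
    have "commutator a c * commutator a t \<in> P" if "a \<in> T" "c \<in> T" "t \<in> T" for a c t
      using commutator_product_in_ideal_core[OF h noncentral T T_mult T_normal] core that by blast
    then have "commutator s t \<in> P" if "s \<in> T" "t \<in> T" for s t
      using commutative_if_commutator_products[OF additive_subgroup_diff[OF T] T_mult T_normal] that
      by blast
    then have "commutator t r \<in> P" if "t \<in> T" for t r
      using central_if_commutative[OF T_normal] that by blast
    then have "commutator w w' \<in> P" if "w \<in> V" "w' \<in> V" for w w'
      using commutative_if_commutators_central[OF normal] VV that by blast
    then show "commutator v x \<in> P"
      using central_if_commutative[OF normal] v by blast
  qed
  then show ?thesis
    unfolding T_def by blast
qed

section \<open>Zero-product balanced algebras\<close>

text \<open>The linear extension of \<open>f\<close> from the basis to the free vector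
  space.\<close>

definition free_extend ::
    "('f::field \<Rightarrow> 'a::ab_group_add \<Rightarrow> 'a) \<Rightarrow> ('x \<Rightarrow> 'a) \<Rightarrow> ('x \<Rightarrow>\<^sub>0 'f) \<Rightarrow> 'a"
  where "free_extend scale f p =
    (\<Sum>i\<in>Poly_Mapping.keys p. scale (Poly_Mapping.lookup p i) (f i))"

context vector_space
begin

lemma free_extend_superset:
  assumes "finite I" "Poly_Mapping.keys p \<subseteq> I"
  shows "free_extend scale f p = (\<Sum>i\<in>I. scale (Poly_Mapping.lookup p i) (f i))"
  unfolding free_extend_def using assms
  by (intro sum.mono_neutral_left) (auto simp: in_keys_iff)

lemma free_extend_add: "free_extend scale f (p + q) = free_extend scale f p + free_extend scale f q"
proof -
  let ?I = "Poly_Mapping.keys p \<union> Poly_Mapping.keys q"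
  have "Poly_Mapping.keys (p + q) \<subseteq> ?I"
    by (rule Poly_Mapping.keys_add)
  then show ?thesis
    by (simp add: free_extend_superset[of ?I] lookup_add scale_left_distrib sum.distrib)
qed

lemma free_extend_scale: "free_extend scale f (free_scale c p) = scale c (free_extend scale f p)"
proof -
  have "Poly_Mapping.keys (free_scale c p) \<subseteq> Poly_Mapping.keys p"
    by (auto simp: in_keys_iff lookup_free_scale)
  then show ?thesis
    by (simp add: free_extend_superset[of "Poly_Mapping.keys p"] lookup_free_scale scale_sum_right)
qed

lemma free_extend_diff: "free_extend scale f (p - q) = free_extend scale f p - free_extend scale f q"
  using free_extend_add[of f "p - q" q] by (simp add: algebra_simps)

lemma free_extend_single: "free_extend scale f (Poly_Mapping.single i 1) = f i"
  by (simp add: free_extend_def)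

end

context associative_algebra
begin

text \<open>This is what lets the linear map \<open>x\<close> \<otimes> \<open>y\<close> \<mapsto>
  \<open>y * x\<close> descend to the tensor product.\<close>

lemma opposite_product_bilinear:
  assumes "p \<in> bilinear_relations scale"
  shows "free_extend scale (\<lambda>(x, y). y * x) p = 0"
proof -
  let ?f = "\<lambda>(x, y). y * x"
  have "free.subspace {p. free_extend scale ?f p = 0}"
    unfolding free.subspace_def
    by (simp add: free_extend_add free_extend_scale) (simp add: free_extend_def)
  then have "bilinear_relations scale \<subseteq> {p. free_extend scale ?f p = 0}"
    unfolding bilinear_relations_def
    by (intro free.span_minimal)
      (auto simp: free_extend_diff free_extend_scale free_extend_single
        distrib_left distrib_right scale_mult_left scale_mult_right)
  then show ?thesis
    using assms by blast
qed

end

text \<open>The map \<open>x\<close> \<otimes> \<open>y\<close> \<mapsto> \<open>y * x\<close> sends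
  the generators with \<open>v * w = 0\<close> to the square-zero elements \<open>w * v\<close>, and
  the balance element for \<open>1, y, z\<close> to \<open>[z,y]\<close>.\<close>

lemma commutator_in_square_zero_span:
  fixes scale :: "'f::field \<Rightarrow> 'a::{ring,monoid_mult} \<Rightarrow> 'a"
  assumes algebra: "associative_algebra scale"
    and balanced: "zero_product_balanced scale"
    and S: "module.subspace scale S"
    and gens: "\<And>v w. v * w = 0 \<Longrightarrow> w * v \<in> S"
  shows "commutator z y \<in> S"
proof -
  interpret associative_algebra scale by fact
  let ?N = "bilinear_relations scale" and ?f = "\<lambda>(x, y). y * x"
  \<comment> \<open>The preimage of \<open>S\<close> under the induced map on the tensor product,
    written with representatives of cosets.\<close>
  let ?W = "{p +o ?N | p. free_extend scale ?f p \<in> S}"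
  have "tensor_subspace scale ?W"
    unfolding tensor_subspace_def
  proof (intro conjI ballI allI)
    show "?W \<subseteq> tensor_space scale"
      by (auto simp: tensor_space_def)
    have "free_extend scale ?f 0 \<in> S"
      using subspace_0[OF S] by (simp add: free_extend_def)
    then have "0 +o ?N \<in> ?W"
      by blast
    then show "?N \<in> ?W"
      by simp
  next
    fix X Y
    assume "X \<in> ?W" "Y \<in> ?W"
    then obtain p q where "X = p +o ?N" "Y = q +o ?N"
      "free_extend scale ?f (p + q) \<in> S"
      using subspace_add[OF S] by (auto simp: free_extend_add)
    then show "X + Y \<in> ?W"
      by (auto simp: coset_add)
  next
    fix c X
    assume "X \<in> ?W"
    then obtain p where "X = p +o ?N" "free_extend scale ?f (free_scale c p) \<in> S"
      using subspace_scale[OF S] by (auto simp: free_extend_scale)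
    then show "tensor_scale scale c X \<in> ?W"
      by (auto simp: coset_scale)
  qed
  moreover have "{tensor scale v w | v w. v * w = 0} \<subseteq> ?W"
    unfolding tensor_def using gens by (force simp: free_extend_single)
  ultimately have "tensor_span scale {tensor scale v w | v w. v * w = 0} \<subseteq> ?W"
    unfolding tensor_span_def by blast
  then have "tensor_diff scale (tensor scale (1 * y) z) (tensor scale 1 (y * z)) \<in> ?W"
    using balanced unfolding zero_product_balanced_def by blast
  then obtain p where p: "free_extend scale ?f p \<in> S"
    and coset: "(free_basis y z - free_basis 1 (y * z)) +o ?N = p +o ?N"
    unfolding tensor_def coset_diff by auto
  have "0 \<in> ?N"
    unfolding bilinear_relations_def by (rule free.span_zero)
  \<comment> \<open>Equal cosets have representatives differing by a bilinear relation, on which the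
    map vanishes.\<close>
  then have "free_basis y z - free_basis 1 (y * z) \<in> p +o ?N"
    using coset set_plus_intro2[of 0 ?N "free_basis y z - free_basis 1 (y * z)"] by simp
  then obtain r where r: "r \<in> ?N" "free_basis y z - free_basis 1 (y * z) = p + r"
    by (auto simp: elt_set_plus_def)
  have "z * y - y * z = free_extend scale ?f (free_basis y z - free_basis 1 (y * z))"
    by (simp add: free_extend_diff free_extend_single)
  also have "\<dots> = free_extend scale ?f p"
    using opposite_product_bilinear[OF r(1)] by (simp add: r(2) free_extend_add)
  finally show ?thesis
    using p by (simp add: commutator_def)
qed

section \<open>From inner invariance to normalisation by commutators\<close>

lemma inner_invariantD:
  assumes "inner_invariant V" "v * v' = 1" "v' * v = 1" "x \<in> V"
  shows "v * x * v' \<in> V"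
  using assms unfolding inner_invariant_def inner_automorphism_def by blast

lemma normalised_if_inner_invariant:
  fixes scale :: "'f::field \<Rightarrow> 'a::{ring,monoid_mult} \<Rightarrow> 'a"
  assumes algebra: "associative_algebra scale"
    and balanced: "zero_product_balanced scale"
    and two: "(2::'f) \<noteq> 0"
    and V: "module.subspace scale V"
    and inv: "inner_invariant V"
    and x: "x \<in> V"
  shows "commutator (commutator y z) x \<in> V"
proof -
  interpret associative_algebra scale by fact
  \<comment> \<open>This set is a linear subspace, so testing it on the elements
    \<open>w * v\<close> with \<open>v * w = 0\<close> suffices.\<close>
  let ?S = "{s. commutator s x \<in> V}"
  have "subspace ?S"
    unfolding subspace_def
    using subspace_0[OF V] subspace_add[OF V] subspace_scale[OF V]
    by (auto simp: commutator_def scale_mult_left scale_mult_right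
      scale_right_diff_distrib[symmetric] distrib_left distrib_right add_diff_add)
  moreover have "w * v \<in> ?S" if "v * w = 0" for v w
  proof -
    define n where "n = w * v"
    have "n * n = w * (v * w) * v"
      by (simp add: n_def mult.assoc)
    then have n: "n * n = 0"
      by (simp add: that)
    have inv1: "(1 + n) * (1 - n) = 1" and inv2: "(1 - n) * (1 + n) = 1"
      by (simp_all add: algebra_simps n)
    have "(1 + n) * x * (1 - n) - (1 - n) * x * (1 + n) \<in> V"
      using subspace_diff[OF V] inner_invariantD[OF inv] inv1 inv2 x by blast
    also have "(1 + n) * x * (1 - n) - (1 - n) * x * (1 + n) = commutator n x + commutator n x"
      by (simp add: commutator_def algebra_simps)
    finally have "scale (1 / 2) (commutator n x + commutator n x) \<in> V"
      using subspace_scale[OF V] by blast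
    also have "scale (1 / 2) (commutator n x + commutator n x) = scale (1 / 2 + 1 / 2) (commutator n x)"
      by (simp only: scale_right_distrib scale_left_distrib)
    also have "\<dots> = commutator n x"
      using two by simp
    finally show ?thesis
      by (simp add: n_def)
  qed
  ultimately have "commutator y z \<in> ?S"
    using commutator_in_square_zero_span[OF algebra balanced] by blast
  then show ?thesis
    by simp
qed

section \<open>Equivalence of the three conditions\<close>

theorem corollary5p7:
  fixes scale :: "'f::field \<Rightarrow> 'a::{ring,monoid_mult} \<Rightarrow> 'a"
    and V :: "'a set"
  assumes "associative_algebra scale"
    and "zero_product_balanced scale"
    and "CHAR('f) \<noteq> 2"
    and "module.subspace scale V"
    and "fully_noncentral V"
  shows "(lie_ideal V \<longleftrightarrow> inner_invariant V) \<and>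
    (inner_invariant V \<longleftrightarrow> commutator_subgroup UNIV UNIV \<subseteq> V)"
proof -
  interpret associative_algebra scale by fact
  note subspace = \<open>module.subspace scale V\<close>
  have V: "additive_subgroup V"
    using subspace_0[OF subspace] subspace_diff[OF subspace] by (simp add: additive_subgroup_def)
  have two: "(2::'f) \<noteq> 0"
  proof
    assume "(2::'f) = 0"
    then have "of_nat 2 = (0::'f)"
      by simp
    then have "CHAR('f) dvd 2"
      by (simp only: of_nat_eq_0_iff_char_dvd)
    then have "CHAR('f) = 1"
      using \<open>CHAR('f) \<noteq> 2\<close> by (metis prime_nat_iff two_is_prime_nat)
    then show False
      by simp
  qed
  \<comment> \<open>One half of the unit of the algebra serves as the \<open>h\<close> of the
    ring-theoretic lemmas.\<close>
  have "scale (1 / 2) 1 + scale (1 / 2) 1 = scale (1 / 2 + 1 / 2) (1::'a)"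
    by (simp only: scale_left_distrib)
  also have "\<dots> = 1"
    using two by simp
  finally have h: "scale (1 / 2) 1 + scale (1 / 2) 1 = (1::'a)" .
  have lie_iff: "lie_ideal V \<longleftrightarrow> (\<forall>a. \<forall>v\<in>V. commutator a v \<in> V)"
    by (simp add: lie_ideal_def V commutator_subgroup_subset_iff)
  have commutators_iff: "commutator_subgroup UNIV UNIV \<subseteq> V \<longleftrightarrow> (\<forall>a b. commutator a b \<in> V)"
    by (simp add: V commutator_subgroup_subset_iff)
  have normalised: "commutator_subgroup UNIV UNIV \<subseteq> V"
    if "\<And>v x y. v \<in> V \<Longrightarrow> commutator (commutator x y) v \<in> V"
    unfolding commutators_iff
    using commutators_subset_if_normalised[OF h \<open>fully_noncentral V\<close> V]
      commutator_mem_swap[OF V that] by blast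
  have "commutator_subgroup UNIV UNIV \<subseteq> V" if "lie_ideal V"
    using that normalised by (simp add: lie_iff)
  moreover have "commutator_subgroup UNIV UNIV \<subseteq> V" if "inner_invariant V"
    using normalised normalised_if_inner_invariant[OF assms(1,2) two subspace that] by blast
  moreover have "lie_ideal V" if "commutator_subgroup UNIV UNIV \<subseteq> V"
    using that by (simp add: lie_iff commutators_iff)
  moreover have "inner_invariant V" if "commutator_subgroup UNIV UNIV \<subseteq> V"
    unfolding inner_invariant_def inner_automorphism_def
  proof (clarify)
    fix v v' x :: 'a
    assume vv': "v' * v = 1" and x: "x \<in> V"
    \<comment> \<open>Conjugation by an invertible element moves \<open>x\<close> only by a
      commutator.\<close>
    have "v * x * v' = commutator v (x * v') + x"
      by (simp add: commutator_def mult.assoc vv')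
    then show "v * x * v' \<in> V"
      using that x additive_subgroup_add[OF V] by (simp add: commutators_iff)
  qed
  ultimately show ?thesis
    by blast
qed

end
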